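(* Let $\mathbf k$ be a field with algebraic closure $\bar{\mathbf k}$, let $V_1,V_2$ be finite-dimensional $\mathbf k$-vector spaces, and let $L\subset (V_1\otimes V_2)^\vee$ be a linear subspace. Then $r_{\mathbf k}(L)\le 2\, r_{\bar{\mathbf k}}(L)$.
   Context: For a linear subspace $L\subset (V_1\otimes V_2)^\vee$ (a linear space of bilinear forms on $V_1\times V_2$), $r_{\mathbf k}(L)$ is the minimum of $\operatorname{codim}_{V_1}(W_1)+\operatorname{codim}_{V_2}(W_2)$ over all pairs of $\mathbf k$-subspaces $W_1\subset V_1$, $W_2\subset V_2$ such that $l|_{W_1\otimes W_2}\equiv 0$ for all $l\in L$. The number $r_{\bar{\mathbf k}}(L)$ is the same quantity for the $\bar{\mathbf k}$-subspace $L\otimes_{\mathbf k}\bar{\mathbf k}$ of $\big((V_1\otimes_{\mathbf k}\bar{\mathbf k})\otimes_{\bar{\mathbf k}}(V_2\otimes_{\mathbf k}\bar{\mathbf k})\big)^\vee$, with $W_i$ ranging over $\bar{\mathbf k}$-subspaces of $V_i\otimes_{\mathbf k}\bar{\mathbf k}$. *)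

theory Defs
  imports
    "HOL-Algebra.Algebraic_Closure_Type"
    "HOL-Computational_Algebra.Group_Closure"
    "HOL-Library.Function_Algebras"
    "HOL-Library.Poly_Mapping"
begin

text \<open>
  A \<open>k\<close>-vector space is given, as in the library theory of vector spaces, by a scalar multiplication
  on a type. Elements of \<open>(V\<^sub>1 \<otimes> V\<^sub>2)\<^sup>\<or>\<close> are represented by bilinear forms on \<open>V\<^sub>1 \<times> V\<^sub>2\<close>; a form
  vanishes on \<open>W\<^sub>1 \<otimes> W\<^sub>2\<close> iff it vanishes at all \<open>(x, y)\<close> with \<open>x \<in> W\<^sub>1\<close> and \<open>y \<in> W\<^sub>2\<close>.
\<close>

definition bilinear_form ::
  "('k::field \<Rightarrow> 'v::ab_group_add \<Rightarrow> 'v) \<Rightarrow> ('k \<Rightarrow> 'w::ab_group_add \<Rightarrow> 'w) \<Rightarrow> ('v \<Rightarrow> 'w \<Rightarrow> 'k) \<Rightarrow> bool"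
  where "bilinear_form s1 s2 l \<longleftrightarrow>
    (\<forall>y. Vector_Spaces.linear s1 (*) (\<lambda>x. l x y)) \<and> (\<forall>x. Vector_Spaces.linear s2 (*) (\<lambda>y. l x y))"

definition form_scale :: "'k::field \<Rightarrow> ('v \<Rightarrow> 'w \<Rightarrow> 'k) \<Rightarrow> 'v \<Rightarrow> 'w \<Rightarrow> 'k"
  where "form_scale c l = (\<lambda>x y. c * l x y)"

lemma vector_space_form_scale: "vector_space form_scale"
  by unfold_locales (auto simp: form_scale_def fun_eq_iff algebra_simps)

text \<open>Only used for subspaces of finite-dimensional spaces, where the subtraction does not truncate.\<close>

definition codim :: "('k::field \<Rightarrow> 'v::ab_group_add \<Rightarrow> 'v) \<Rightarrow> 'v set \<Rightarrow> nat"
  where "codim s W = vector_space.dim s UNIV - vector_space.dim s W"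

text \<open>The number \<open>r(L)\<close>. The minimum is over a nonempty set: \<open>W\<^sub>1 = W\<^sub>2 = 0\<close> is admissible.\<close>

definition form_rank ::
  "('k::field \<Rightarrow> 'v::ab_group_add \<Rightarrow> 'v) \<Rightarrow> ('k \<Rightarrow> 'w::ab_group_add \<Rightarrow> 'w) \<Rightarrow> ('v \<Rightarrow> 'w \<Rightarrow> 'k) set \<Rightarrow> nat"
  where "form_rank s1 s2 L = (LEAST n. \<exists>W1 W2.
    module.subspace s1 W1 \<and> module.subspace s2 W2 \<and>
    (\<forall>l\<in>L. \<forall>x\<in>W1. \<forall>y\<in>W2. l x y = 0) \<and>
    n = codim s1 W1 + codim s2 W2)"

text \<open>
  The tensor product \<open>V \<otimes>\<^sub>k K\<close> along a field embedding \<open>emb : k \<rightarrow> K\<close> is the free abelian group on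
  \<open>V \<times> K\<close> modulo the subgroup generated by the following relations, with \<open>K\<close> acting on the second
  factor.
\<close>

definition tensor_relations ::
  "('k::field \<Rightarrow> 'K::field) \<Rightarrow> ('k \<Rightarrow> 'v::ab_group_add \<Rightarrow> 'v) \<Rightarrow> ('v \<times> 'K \<Rightarrow>\<^sub>0 int) set"
  where "tensor_relations emb s =
    {frag_of (x + y, a) - frag_of (x, a) - frag_of (y, a) | x y a. True} \<union>
    {frag_of (x, a + b) - frag_of (x, a) - frag_of (x, b) | x a b. True} \<union>
    {frag_of (s c x, a) - frag_of (x, emb c * a) | c x a. True}"

definition tensor_eval ::
  "('K::field \<Rightarrow> 'u::ab_group_add \<Rightarrow> 'u) \<Rightarrow> ('v \<Rightarrow> 'K \<Rightarrow> 'u) \<Rightarrow> ('v \<times> 'K \<Rightarrow>\<^sub>0 int) \<Rightarrow> 'u"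
  where "tensor_eval t \<tau> f =
    (\<Sum>(x, a)\<in>Poly_Mapping.keys f. t (of_int (Poly_Mapping.lookup f (x, a))) (\<tau> x a))"

text \<open>
  The quotient depends on \<open>s\<close>, so it is not a type of its own; instead, the locale says that the
  \<open>K\<close>-vector space \<open>U\<close> with scalar multiplication \<open>t\<close>, together with the map \<open>\<tau> x a = x \<otimes> a\<close>, is (a copy
  of) \<open>V \<otimes>\<^sub>k K\<close>: the homomorphism from the free abelian group given by \<open>\<tau>\<close> is onto \<open>U\<close> and its kernel
  is exactly the subgroup of relations.
\<close>

locale scalar_extension = base: vector_space s + ext: vector_space t
  for emb :: "'k::field \<Rightarrow> 'K::field"
    and s :: "'k \<Rightarrow> 'v::ab_group_add \<Rightarrow> 'v"
    and t :: "'K \<Rightarrow> 'u::ab_group_add \<Rightarrow> 'u"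
    and \<tau> :: "'v \<Rightarrow> 'K \<Rightarrow> 'u" +
  assumes scale_tensor: "t b (\<tau> x a) = \<tau> x (b * a)"
    and surj_tensor_eval: "surj (tensor_eval t \<tau>)"
    and kernel_tensor_eval: "{f. tensor_eval t \<tau> f = 0} = group_closure (tensor_relations emb s)"

text \<open>
  \<open>L \<otimes>\<^sub>k K\<close> as a space of bilinear forms over \<open>K\<close>: the \<open>K\<close>-span of the extensions \<open>l'\<close> of the \<open>l \<in> L\<close>,
  where \<open>l' (x \<otimes> a) (y \<otimes> b) = l x y a b\<close>.
\<close>

definition extend_forms ::
  "('k::field \<Rightarrow> 'K::field) \<Rightarrow>
   ('K \<Rightarrow> 'u1::ab_group_add \<Rightarrow> 'u1) \<Rightarrow> ('v1 \<Rightarrow> 'K \<Rightarrow> 'u1) \<Rightarrow>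
   ('K \<Rightarrow> 'u2::ab_group_add \<Rightarrow> 'u2) \<Rightarrow> ('v2 \<Rightarrow> 'K \<Rightarrow> 'u2) \<Rightarrow>
   ('v1 \<Rightarrow> 'v2 \<Rightarrow> 'k) set \<Rightarrow> ('u1 \<Rightarrow> 'u2 \<Rightarrow> 'K) set"
  where "extend_forms emb t1 \<tau>1 t2 \<tau>2 L = module.span form_scale
    {l'. bilinear_form t1 t2 l' \<and>
      (\<exists>l\<in>L. \<forall>x a y b. l' (\<tau>1 x a) (\<tau>2 y b) = emb (l x y) * a * b)}"

end

theory Submission
  imports Defs
begin

text \<open>
  In fact \<open>r\<^sub>k(L) \<le> r\<^sub>K(L)\<close> for every algebraic extension \<open>K\<close> of \<open>k\<close>. Let \<open>W\<^sub>1, W\<^sub>2\<close> be subspaces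
  over \<open>K\<close> on which the extended forms vanish, and let \<open>A \<subseteq> K\<close> be a \<open>k\<close>-subspace of finite dimension
  \<open>d > 0\<close> stable under multiplication by the finitely many coordinates of a basis of \<open>W\<^sub>1\<close>. The
  combinations of this basis with coefficients in \<open>A\<close> form a \<open>k\<close>-subspace
  \<open>U \<subseteq> V\<^sub>1 \<otimes> A \<cong> V\<^sub>1\<^sup>d\<close> of dimension \<open>d \<cdot> dim W\<^sub>1\<close>, and the forms in \<open>L\<close> map \<open>U\<close> into a space
  \<open>Z\<close> of linear maps on \<open>V\<^sub>2\<close> of dimension at most \<open>d \<cdot> codim W\<^sub>2\<close>. Filter \<open>V\<^sub>1\<^sup>d\<close> by the coordinate flag:
  the graded pieces \<open>U\<^sub>i \<subseteq> V\<^sub>1\<close> of \<open>U\<close> are mapped by \<open>L\<close> into the graded pieces \<open>Z\<^sub>i\<close> of \<open>Z\<close>, so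
  \<open>U\<^sub>i\<close> and the annihilator of \<open>Z\<^sub>i\<close> give \<open>r\<^sub>k(L) \<le> codim U\<^sub>i + dim Z\<^sub>i\<close>. Summing over \<open>i\<close> and
  dividing by \<open>d\<close> yields \<open>r\<^sub>k(L) \<le> codim W\<^sub>1 + codim W\<^sub>2\<close>.
\<close>

subsection \<open>Dimension counts\<close>

context vector_space_pair
begin

text \<open>Lift a finite basis of the image to \<open>S\<close>; what remains of an element of
  \<open>S\<close> lies in the kernel. This carries finiteness through the induction in
  \<open>finitely_supported_functions\<close>, where the ambient function space may have infinite
  dimension.\<close>

lemma finite_span_of_kernel_and_image:
  assumes f: "Vector_Spaces.linear s1 s2 f" and S: "vs1.subspace S"
    and ker: "finite F" "{x\<in>S. f x = 0} \<subseteq> vs1.span F"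
    and im: "finite G" "f ` S \<subseteq> vs2.span G"
  shows "\<exists>F. finite F \<and> S \<subseteq> vs1.span F"
proof -
  obtain C where C: "C \<subseteq> f ` S" "vs2.independent C" "f ` S \<subseteq> vs2.span C"
    using vs2.maximal_independent_subset by blast
  have "finite C"
    using vs2.independent_span_bound[OF im(1) C(2)] C(1) im(2) by blast
  then obtain D where D: "D \<subseteq> S" "finite D" "C = f ` D"
    using C(1) finite_subset_image by meson
  have "x \<in> vs1.span (F \<union> D)" if x: "x \<in> S" for x
  proof -
    have "f x \<in> f ` vs1.span D"
      using C(3) x D(3) linear_span_image[OF f] by auto
    then obtain d where d: "d \<in> vs1.span D" "f x = f d" by blast
    have "d \<in> S"
      using d(1) D(1) S vs1.span_minimal by blast
    then have "x - d \<in> {x\<in>S. f x = 0}"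
      using x d(2) S by (simp add: vs1.subspace_diff linear_diff[OF f])
    then have "x - d \<in> vs1.span (F \<union> D)"
      using ker(2) vs1.span_mono[of F "F \<union> D"] by blast
    moreover have "d \<in> vs1.span (F \<union> D)"
      using d(1) vs1.span_mono[of D "F \<union> D"] by blast
    ultimately have "x - d + d \<in> vs1.span (F \<union> D)"
      by (rule vs1.span_add)
    then show ?thesis by simp
  qed
  then show ?thesis
    using ker(1) D(2) by (intro exI[of _ "F \<union> D"]) auto
qed

text \<open>A basis \<open>C\<close> of the kernel is extended to a basis \<open>B\<close> of
  \<open>S\<close>, and \<open>f\<close> maps \<open>B - C\<close> bijectively onto a basis of the
  image. Finiteness is asked of \<open>S\<close> alone because the ambient space may be
  infinite-dimensional.\<close>

lemma rank_nullity:
  assumes f: "Vector_Spaces.linear s1 s2 f" and S: "vs1.subspace S"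
    and F: "finite F" "S \<subseteq> vs1.span F"
  shows "vs1.dim S = vs2.dim (f ` S) + vs1.dim {x\<in>S. f x = 0}"
proof -
  define K where "K = {x\<in>S. f x = 0}"
  obtain C where C: "C \<subseteq> K" "vs1.independent C" "K \<subseteq> vs1.span C"
    using vs1.maximal_independent_subset by blast
  have "C \<subseteq> S" using C(1) K_def by auto
  then obtain B where B: "C \<subseteq> B" "B \<subseteq> S" "vs1.independent B" "S \<subseteq> vs1.span B"
    using vs1.maximal_independent_subset_extend[OF _ C(2)] by blast
  have finB: "finite B"
    using vs1.independent_span_bound[OF F(1) B(3)] B(2) F(2) by blast
  define D where "D = B - C"
  have indD: "vs1.independent D"
    using B(3) D_def by (meson Diff_subset vs1.independent_mono)
  have DS: "vs1.span D \<subseteq> S"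
    using B(2) D_def S by (intro vs1.span_minimal) auto
  have zero: "x = 0" if x: "x \<in> vs1.span D" "f x = 0" for x
  proof -
    \<comment> \<open>The representations of \<open>x\<close> in \<open>C\<close>, \<open>D\<close>
      and \<open>B\<close> all agree, while \<open>C\<close> and \<open>D\<close> are disjoint, so
      every coefficient vanishes.\<close>
    have "x \<in> vs1.span C" using x DS C(3) K_def by auto
    then have 1: "vs1.representation C x = vs1.representation B x"
      using B(1,3) vs1.representation_extend by metis
    have 2: "vs1.representation D x = vs1.representation B x"
      using B(3) x(1) vs1.representation_extend[of B x D] D_def by auto
    have "vs1.representation B x b = 0" for b
      using 1 2 D_def vs1.representation_ne_zero[of C x b] vs1.representation_ne_zero[of D x b]
      by (metis DiffD2)
    then show "x = 0"
      using vs1.sum_nonzero_representation_eq[OF indD x(1)] 2 by simp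
  qed
  have inj: "inj_on f (vs1.span D)"
    using zero linear_inj_on_iff_eq_0[OF f vs1.subspace_span, of D] by blast
  have indf: "vs2.independent (f ` D)"
    using linear_independent_injective_image[OF f indD inj] .
  have img: "f ` S \<subseteq> vs2.span (f ` D)"
  proof
    fix y assume "y \<in> f ` S"
    then obtain x where x: "x \<in> S" "y = f x" by blast
    have "x \<in> vs1.span (C \<union> D)" using x(1) B(1,4) D_def by (simp add: Un_absorb1 subset_iff)
    then obtain u v where uv: "x = u + v" "u \<in> vs1.span C" "v \<in> vs1.span D"
      by (auto simp: vs1.span_Un)
    have "f u = 0"
      using uv(2) by (rule linear_eq_on[OF f linear_zero]) (use C(1) K_def in auto)
    then have "y = f v" using x uv(1) linear_add[OF f] by simp
    then show "y \<in> vs2.span (f ` D)" using uv(3) linear_span_image[OF f] by blast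
  qed
  have "vs2.dim (f ` S) = card (f ` D)"
    using vs2.dim_unique[OF _ img indf refl] B(2) D_def by blast
  also have "\<dots> = card D"
    using inj card_image inj_on_subset vs1.span_superset by metis
  finally have "vs2.dim (f ` S) = card D" .
  moreover have "vs1.dim K = card C"
    using C vs1.dim_unique by blast
  moreover have "vs1.dim S = card B"
    using B vs1.dim_unique by blast
  moreover have "card B = card D + card C"
    using finB B(1) D_def by (metis card_Diff_subset card_mono finite_subset le_add_diff_inverse2)
  ultimately show ?thesis by (simp add: K_def)
qed

end

lemma vector_space_times: "vector_space ((*) :: 'k::field \<Rightarrow> 'k \<Rightarrow> 'k)"
  by unfold_locales (auto simp: algebra_simps)

lemma dim_field_le_1:
  fixes A :: "'k::field set"
  shows "vector_space.dim (*) A \<le> 1"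
proof -
  interpret vector_space "(*) :: 'k \<Rightarrow> 'k \<Rightarrow> 'k" by (rule vector_space_times)
  have "A \<subseteq> span {1}"
    using span_scale[OF span_base[of 1 "{1}"]] by fastforce
  then show ?thesis using dim_le_card[of A "{1}"] by simp
qed

text \<open>Each further functional costs at most one dimension, because its image lies in the
  one-dimensional space of scalars.\<close>

lemma codim_annihilator_le:
  assumes fd: "finite_dimensional_vector_space s B" and "finite H"
    and "\<And>h. h \<in> H \<Longrightarrow> Vector_Spaces.linear s (*) h"
  shows "module.subspace s {y. \<forall>h\<in>H. h y = 0} \<and> codim s {y. \<forall>h\<in>H. h y = 0} \<le> card H"
  using assms(2,3)
proof (induction H)
  case empty
  interpret finite_dimensional_vector_space s B by fact
  show ?case by (simp add: codim_def)
next
  case (insert h H)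
  interpret finite_dimensional_vector_space s B by fact
  interpret vector_space_pair s "(*)" by unfold_locales (auto simp: algebra_simps)
  let ?S = "{y. \<forall>h\<in>H. h y = 0}"
  have h: "Vector_Spaces.linear s (*) h" using insert.prems by simp
  have IH: "subspace ?S" "codim s ?S \<le> card H" using insert by auto
  have eq: "{y. \<forall>h\<in>insert h H. h y = 0} = {y\<in>?S. h y = 0}" by auto
  have "subspace {y\<in>?S. h y = 0}"
    using IH(1) by (auto simp: subspace_def linear_0[OF h] linear_add[OF h] linear_scale[OF h])
  moreover have "dim ?S = vector_space.dim (*) (h ` ?S) + dim {y\<in>?S. h y = 0}"
    using rank_nullity[OF h IH(1) finite_Basis] by (simp add: span_Basis)
  then have "codim s {y\<in>?S. h y = 0} \<le> Suc (card H)"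
    using dim_field_le_1[of "h ` ?S"] IH(2) unfolding codim_def by linarith
  ultimately show ?case
    using insert.hyps unfolding eq by simp
qed

text \<open>Serves both for families of coefficients in \<open>K\<close>, which replace tuples of a
  length unknown to the types, and for scalar functions on \<open>V\<^sub>2\<close>, among which its
  dual lies.\<close>

definition fun_scale :: "('k \<Rightarrow> 'w \<Rightarrow> 'w) \<Rightarrow> 'k \<Rightarrow> ('a \<Rightarrow> 'w) \<Rightarrow> 'a \<Rightarrow> 'w"
  where "fun_scale s c g = (\<lambda>x. s c (g x))"

lemma (in vector_space) vector_space_fun_scale: "vector_space (fun_scale scale)"
  by unfold_locales (auto simp: fun_scale_def fun_eq_iff algebra_simps)

text \<open>\<open>G S\<close> is a model of the power of \<open>A\<close> indexed by
  \<open>S\<close>. Evaluation at a new index has image \<open>A\<close> and kernel the functions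
  supported on the old indices, so rank-nullity gives the induction.\<close>

lemma (in vector_space) finitely_supported_functions:
  fixes S :: "'c set"
  assumes A: "subspace A" "finite F" "A \<subseteq> span F" and S: "finite S"
  defines "G \<equiv> \<lambda>S::'c set. {g. (\<forall>x. x \<notin> S \<longrightarrow> g x = 0) \<and> (\<forall>x. g x \<in> A)}"
  shows "module.subspace (fun_scale scale) (G S) \<and>
    (\<exists>F. finite F \<and> G S \<subseteq> module.span (fun_scale scale) F) \<and>
    vector_space.dim (fun_scale scale) (G S) = card S * dim A"
proof -
  interpret fs: vector_space "fun_scale scale :: 'a \<Rightarrow> ('c \<Rightarrow> 'b) \<Rightarrow> ('c \<Rightarrow> 'b)"
    by (rule vector_space_fun_scale)
  interpret vector_space_pair "fun_scale scale :: 'a \<Rightarrow> ('c \<Rightarrow> 'b) \<Rightarrow> ('c \<Rightarrow> 'b)" scale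
    by unfold_locales
  have sub: "fs.subspace (G S)" for S
    using A(1) by (auto simp: fs.subspace_def subspace_def G_def fun_scale_def)
  have "(\<exists>F. finite F \<and> G S \<subseteq> fs.span F) \<and> fs.dim (G S) = card S * dim A"
    using S
  proof induction
    case empty
    have "G {} = {0}" using A(1) by (auto simp: G_def subspace_0)
    then show ?case using fs.dim_span_eq_card_independent[OF fs.independent_empty]
      by (auto intro!: exI[of _ "{0}"])
  next
    case (insert a S)
    let ?e = "\<lambda>g::'c \<Rightarrow> 'b. g a"
    have e: "Vector_Spaces.linear (fun_scale scale) scale ?e"
      by unfold_locales (auto simp: fun_scale_def)
    have ker: "{g \<in> G (insert a S). ?e g = 0} = G S"
      using insert.hyps by (auto simp: G_def)
    have "x \<in> ?e ` G (insert a S)" if "x \<in> A" for x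
      using that subspace_0[OF A(1)]
      by (intro image_eqI[of _ _ "\<lambda>y. if y = a then x else 0"]) (auto simp: G_def)
    then have im: "?e ` G (insert a S) = A" by (auto simp: G_def)
    obtain F' where "finite F'" "G S \<subseteq> fs.span F'" using insert.IH by blast
    then obtain F'' where F'': "finite F''" "G (insert a S) \<subseteq> fs.span F''"
      using finite_span_of_kernel_and_image[OF e sub[of "insert a S"], of F' F] A(2,3)
      unfolding ker im by blast
    then show ?case
      using rank_nullity[OF e sub F''] insert unfolding ker im by auto
  qed
  then show ?thesis using sub by blast
qed

text \<open>
  Here \<open>p i\<close> and \<open>q i\<close> are the coordinates of \<open>V\<^sub>1\<^sup>d\<close> and of \<open>(V\<^sub>2\<^sup>\<or>)\<^sup>d\<close>. Removing one index
  replaces \<open>U\<close> and \<open>Z\<close> by the kernels of \<open>p i\<close> and \<open>q i\<close> and splits off the images.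
\<close>

lemma flag_dimension_inequality:
  fixes s1 :: "'k::field \<Rightarrow> 'v1::ab_group_add \<Rightarrow> 'v1"
    and s2 :: "'k \<Rightarrow> 'v2::ab_group_add \<Rightarrow> 'v2"
    and sX :: "'k \<Rightarrow> 'x::ab_group_add \<Rightarrow> 'x"
    and sY :: "'k \<Rightarrow> 'y::ab_group_add \<Rightarrow> 'y"
  assumes fd1: "finite_dimensional_vector_space s1 B1"
    and fd2: "finite_dimensional_vector_space s2 B2"
    and vX: "vector_space sX" and vY: "vector_space sY"
    and p: "\<And>i. Vector_Spaces.linear sX s1 (p i)"
    and q: "\<And>i. Vector_Spaces.linear sY (fun_scale (*)) (q i)"
    and q2: "\<And>i z. Vector_Spaces.linear s2 (*) (q i z)"
    and r: "\<And>W1 W2. module.subspace s1 W1 \<Longrightarrow> module.subspace s2 W2 \<Longrightarrow>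
      (\<forall>l\<in>L. \<forall>x\<in>W1. \<forall>y\<in>W2. l x y = 0) \<Longrightarrow> r \<le> codim s1 W1 + codim s2 W2"
    and l0: "\<And>l. l \<in> L \<Longrightarrow> l 0 = 0"
    and "finite I"
    and "module.subspace sX U" "finite F" "U \<subseteq> module.span sX F"
    and "module.subspace sY Z" "finite G" "Z \<subseteq> module.span sY G"
    and "\<And>u. u \<in> U \<Longrightarrow> \<forall>i\<in>I. p i u = 0 \<Longrightarrow> u = 0"
    and "\<And>l u. l \<in> L \<Longrightarrow> u \<in> U \<Longrightarrow> \<exists>z\<in>Z. \<forall>i\<in>I. q i z = l (p i u)"
  shows "vector_space.dim sX U + card I * r
    \<le> card I * vector_space.dim s1 UNIV + vector_space.dim sY Z"
proof -
  interpret V1: finite_dimensional_vector_space s1 B1 by fact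
  interpret V2: finite_dimensional_vector_space s2 B2 by fact
  interpret X: vector_space sX by fact
  interpret Y: vector_space sY by fact
  interpret K: vector_space "(*) :: 'k \<Rightarrow> 'k \<Rightarrow> 'k" by (rule vector_space_times)
  interpret D: vector_space "fun_scale (*) :: 'k \<Rightarrow> ('v2 \<Rightarrow> 'k) \<Rightarrow> ('v2 \<Rightarrow> 'k)"
    by (rule K.vector_space_fun_scale)
  interpret XV: vector_space_pair sX s1 by unfold_locales
  interpret YD: vector_space_pair sY "fun_scale (*) :: 'k \<Rightarrow> ('v2 \<Rightarrow> 'k) \<Rightarrow> ('v2 \<Rightarrow> 'k)"
    by unfold_locales
  note finU = \<open>finite F\<close> and finZ = \<open>finite G\<close>
  show ?thesis
    using assms(10,11,13,14,16-)
  proof (induction I arbitrary: U Z)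
    case empty
    then have "U \<subseteq> {0}" by auto
    then have "X.dim U = 0"
      using X.dim_le_card[of U "{}"] by simp
    then show ?case by simp
  next
    case (insert i I)
    note U = insert.prems(1,2) and Z = insert.prems(3,4) and
      inj = insert.prems(5) and hyp = insert.prems(6)
    let ?U = "{u\<in>U. p i u = 0}" and ?Z = "{z\<in>Z. q i z = 0}"
    have dU: "X.dim U = V1.dim (p i ` U) + X.dim ?U"
      by (rule XV.rank_nullity[OF p U(1) finU U(2)])
    have dZ: "Y.dim Z = D.dim (q i ` Z) + Y.dim ?Z"
      by (rule YD.rank_nullity[OF q Z(1) finZ Z(2)])
    have "X.dim ?U + card I * r \<le> card I * V1.dim UNIV + Y.dim ?Z"
    proof (rule insert.IH)
      show "X.subspace ?U"
        using U(1) by (auto simp: X.subspace_def XV.linear_0[OF p] XV.linear_add[OF p] XV.linear_scale[OF p])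
      show "Y.subspace ?Z"
        using Z(1) by (auto simp: Y.subspace_def YD.linear_0[OF q] YD.linear_add[OF q]
          YD.linear_scale[OF q] fun_scale_def fun_eq_iff)
      show "u = 0" if "u \<in> ?U" "\<forall>i\<in>I. p i u = 0" for u
        using inj that by auto
      show "\<exists>z\<in>?Z. \<forall>i\<in>I. q i z = l (p i u)" if l: "l \<in> L" and u: "u \<in> ?U" for l u
      proof -
        obtain z where z: "z \<in> Z" "\<forall>j\<in>insert i I. q j z = l (p j u)"
          using hyp[OF l, of u] u by blast
        \<comment> \<open>As \<open>p i u = 0\<close>, the partner \<open>z\<close> is forced into
          the kernel of \<open>q i\<close>, so the hypothesis linking \<open>U\<close> and
          \<open>Z\<close> is inherited by the kernels.\<close>
        then have "q i z = 0" using u l0[OF l] by simp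
        then show ?thesis using z by auto
      qed
    qed (use U Z in auto)
    \<comment> \<open>The graded piece \<open>p i\<close> U\<open>and the annihilator of\<close>q i
      \<open>Z\<close> form a pair on which all of \<open>L\<close> vanishes.\<close>
    moreover have "r \<le> codim s1 (p i ` U) + D.dim (q i ` Z)"
    proof -
      obtain H where H: "H \<subseteq> q i ` Z" "D.independent H" "q i ` Z \<subseteq> D.span H" "card H = D.dim (q i ` Z)"
        using D.basis_exists by blast
      have "q i ` Z \<subseteq> D.span (q i ` G)"
        using Z(2) YD.linear_span_image[OF q, of i G] by blast
      then have finH: "finite H"
        using D.independent_span_bound[of "q i ` G" H] H(1,2) finZ by blast
      let ?W = "{y. \<forall>h\<in>H. h y = 0}"
      have W: "V2.subspace ?W" "codim s2 ?W \<le> card H"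
        using codim_annihilator_le[OF fd2 finH] H(1) q2 by blast+
      have "\<forall>l\<in>L. \<forall>x\<in>p i ` U. \<forall>y\<in>?W. l x y = 0"
      proof (intro ballI)
        fix l x y assume l: "l \<in> L" and "x \<in> p i ` U" and y: "y \<in> ?W"
        then obtain u where u: "u \<in> U" "x = p i u" by blast
        obtain z where z: "z \<in> Z" "q i z = l x" using hyp[OF l u(1)] u(2) by auto
        then have "l x \<in> D.span H" using H(3) by (metis imageI subsetD)
        then show "l x y = 0"
        proof (induction rule: D.span_induct_alt)
          case base then show ?case by simp
        next
          case (step c h g) then show ?case using y by (simp add: fun_scale_def)
        qed
      qed
      moreover have "V1.subspace (p i ` U)"
        using XV.linear_subspace_image[OF p U(1)] .
      ultimately have "r \<le> codim s1 (p i ` U) + codim s2 ?W"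
        using r W(1) by blast
      then show ?thesis using W(2) H(4) by simp
    qed
    \<comment> \<open>Ensures that the subtraction in \<open>codim\<close> does not
      truncate.\<close>
    moreover have "V1.dim (p i ` U) \<le> V1.dim UNIV"
      by (rule V1.dim_subset) simp
    ultimately show ?case
      using dU dZ insert.hyps by (simp add: codim_def)
  qed
qed

subsection \<open>Algebraic extensions\<close>

text \<open>Algebraicity is stated as a monic equation, ready for rewriting the top power of
  \<open>c\<close> by lower ones.\<close>

locale algebraic_extension =
  fixes emb :: "'k::field \<Rightarrow> 'K::field"
  assumes emb_add: "emb (a + b) = emb a + emb b"
    and emb_mult: "emb (a * b) = emb a * emb b"
    and emb_1: "emb 1 = 1"
    and power_in_lower_powers: "\<exists>n a. n > 0 \<and> c ^ n = (\<Sum>i<n. emb (a i) * c ^ i)"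
begin

lemma emb_0: "emb 0 = 0"
  using emb_add[of 0 0] by (metis add_cancel_right_right)

lemma emb_sum: "emb (sum f A) = (\<Sum>x\<in>A. emb (f x))"
  by (induction A rule: infinite_finite_induct) (auto simp: emb_0 emb_add)

sublocale K: vector_space "\<lambda>c. (*) (emb c)"
  by unfold_locales (auto simp: emb_add emb_mult emb_1 algebra_simps)

lemma linear_times: "Vector_Spaces.linear (\<lambda>c. (*) (emb c)) (\<lambda>c. (*) (emb c)) ((*) a)"
  by unfold_locales (auto simp: algebra_simps)

text \<open>Elements of \<open>C\<close> are adjoined one at a time: the spanning set is multiplied
  by the powers of \<open>c\<close> below the degree of its monic equation. Keeping 1 in
  \<open>F\<close> makes the span nonzero.\<close>

lemma finite_stable_subspace:
  assumes "finite C"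
  shows "\<exists>F. finite F \<and> 1 \<in> F \<and> (\<forall>c\<in>C. \<forall>a\<in>K.span F. c * a \<in> K.span F)"
  using assms
proof induction
  case empty
  then show ?case by (auto intro!: exI[of _ "{1}"])
next
  case (insert c C)
  interpret KK: vector_space_pair "\<lambda>c. (*) (emb c)" "\<lambda>c. (*) (emb c)" by unfold_locales
  obtain F where F: "finite F" "1 \<in> F" and C: "\<And>d a. d \<in> C \<Longrightarrow> a \<in> K.span F \<Longrightarrow> d * a \<in> K.span F"
    using insert.IH by blast
  obtain n a where n: "n > 0" "c ^ n = (\<Sum>i<n. emb (a i) * c ^ i)"
    using power_in_lower_powers by blast
  define F' where "F' = (\<lambda>(i, x). c ^ i * x) ` ({..<n} \<times> F)"
  have F': "c ^ i * x \<in> F'" if "i < n" "x \<in> F" for i x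
    using that unfolding F'_def by force
  have stable: "d * y \<in> K.span F'" if "\<And>x. x \<in> F' \<Longrightarrow> d * x \<in> K.span F'" "y \<in> K.span F'" for d y
  proof -
    have "(*) d ` K.span F' = K.span ((*) d ` F')"
      by (rule KK.linear_span_image[OF linear_times, symmetric])
    also have "\<dots> \<subseteq> K.span F'"
      using that(1) by (intro K.span_minimal) auto
    finally show ?thesis using that(2) by blast
  qed
  have "c * x \<in> K.span F'" if x: "x \<in> F'" for x
  proof -
    obtain i y where iy: "i < n" "y \<in> F" "x = c ^ i * y" using x by (auto simp: F'_def)
    show ?thesis
    proof (cases "Suc i < n")
      case True
      have "c * x = c ^ Suc i * y" by (simp add: iy(3) mult.assoc)
      then show ?thesis using K.span_base[OF F'[OF True iy(2)]] by (simp only:)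
    next
      case False
      then have "n = Suc i" using iy(1) False by simp
      \<comment> \<open>At the top exponent the product leaves \<open>F'\<close>, and the monic
        equation brings it back into the span.\<close>
      then have "c * x = c ^ n * y" by (simp add: iy(3) mult.assoc)
      also have "\<dots> = (\<Sum>i<n. emb (a i) * (c ^ i * y))"
        by (simp add: n(2) sum_distrib_right mult.assoc)
      also have "\<dots> \<in> K.span F'"
        using F' iy(2) by (intro K.span_sum K.span_scale K.span_base) auto
      finally show ?thesis .
    qed
  qed
  moreover have "d * x \<in> K.span F'" if d: "d \<in> C" and x: "x \<in> F'" for d x
  proof -
    obtain i y where iy: "i < n" "y \<in> F" "x = c ^ i * y" using x by (auto simp: F'_def)
    \<comment> \<open>Stability under the earlier elements survives because \<open>d\<close>
      commutes with the powers of \<open>c\<close>.\<close>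
    have "d * y \<in> K.span F" using C d iy(2) K.span_base by blast
    then have "c ^ i * (d * y) \<in> K.span ((*) (c ^ i) ` F)"
      using KK.linear_span_image[OF linear_times, of "c ^ i" F] by blast
    also have "\<dots> \<subseteq> K.span F'"
      using F' iy(1) by (intro K.span_mono) auto
    finally show ?thesis by (simp add: iy(3) mult.left_commute)
  qed
  moreover have "1 \<in> F'" using F'[of 0 1] n(1) F(2) by simp
  moreover have "finite F'" using F(1) by (simp add: F'_def)
  ultimately show ?case
    by (intro exI[of _ F']) (auto intro: stable)
qed

end

lemma algebraic_extension_to_ac: "algebraic_extension (to_ac :: 'k::field \<Rightarrow> 'k alg_closure)"
proof
  fix c :: "'k alg_closure"
  obtain p :: "'k poly" where p: "p \<noteq> 0" "poly (map_poly to_ac p) c = 0"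
    using alg_closure_algebraic by blast
  let ?n = "degree p" and ?l = "lead_coeff p"
  have "0 = (\<Sum>i\<le>?n. to_ac (coeff p i) * c ^ i)"
    using p(2) by (simp add: poly_altdef degree_map_poly coeff_map_poly)
  also have "\<dots> = (\<Sum>i<?n. to_ac (coeff p i) * c ^ i) + to_ac ?l * c ^ ?n"
    by (simp flip: lessThan_Suc_atMost)
  finally have "to_ac ?l * c ^ ?n = - (\<Sum>i<?n. to_ac (coeff p i) * c ^ i)"
    by (simp add: eq_neg_iff_add_eq_0 add.commute)
  moreover have l: "to_ac ?l \<noteq> 0" using p(1) by simp
  ultimately have eq: "c ^ ?n = - (\<Sum>i<?n. to_ac (coeff p i) * c ^ i) / to_ac ?l"
    by (simp add: field_simps)
  have "c ^ ?n = (\<Sum>i<?n. to_ac (- coeff p i / ?l) * c ^ i)"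
    unfolding eq by (simp add: sum_divide_distrib sum_negf)
  \<comment> \<open>In degree 0 the equation would read 1 = 0.\<close>
  moreover from this have "?n > 0" by (cases "?n = 0") auto
  ultimately show "\<exists>n a. n > 0 \<and> c ^ n = (\<Sum>i<n. to_ac (a i) * c ^ i)"
    by (intro exI[of _ ?n] exI[of _ "\<lambda>i. - coeff p i / ?l"]) simp
qed auto

subsection \<open>Extension of scalars\<close>

context vector_space
begin

lemma tensor_eval_superset:
  assumes "finite S" "Poly_Mapping.keys f \<subseteq> S"
  shows "tensor_eval scale \<tau> f =
    (\<Sum>(x, a)\<in>S. scale (of_int (Poly_Mapping.lookup f (x, a))) (\<tau> x a))"
  unfolding tensor_eval_def
  by (rule sum.mono_neutral_left[OF assms]) (auto simp: in_keys_iff)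

lemma tensor_eval_0: "tensor_eval scale \<tau> 0 = 0"
  by (simp add: tensor_eval_def)

lemma tensor_eval_frag_of: "tensor_eval scale \<tau> (frag_of (x, a)) = \<tau> x a"
  by (simp add: tensor_eval_def)

lemma tensor_eval_diff: "tensor_eval scale \<tau> (f - g) = tensor_eval scale \<tau> f - tensor_eval scale \<tau> g"
proof -
  let ?S = "Poly_Mapping.keys f \<union> Poly_Mapping.keys g"
  have "Poly_Mapping.keys (f - g) \<subseteq> ?S" by (rule keys_diff)
  then show ?thesis
    by (simp add: tensor_eval_superset[of ?S] lookup_minus scale_left_diff_distrib
        split_def sum_subtractf)
qed

end

context scalar_extension
begin

lemma tensor_relation: "f \<in> tensor_relations emb s \<Longrightarrow> tensor_eval t \<tau> f = 0"
  using kernel_tensor_eval group_closure.base by blast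

lemma tensor_add_left: "\<tau> (x + y) a = \<tau> x a + \<tau> y a"
proof -
  have "frag_of (x + y, a) - frag_of (x, a) - frag_of (y, a) \<in> tensor_relations emb s"
    unfolding tensor_relations_def by blast
  from tensor_relation[OF this] show ?thesis
    by (simp add: ext.tensor_eval_diff ext.tensor_eval_frag_of diff_eq_eq add.commute)
qed

lemma tensor_scale_left: "\<tau> (s c x) a = \<tau> x (emb c * a)"
proof -
  have "frag_of (s c x, a) - frag_of (x, emb c * a) \<in> tensor_relations emb s"
    unfolding tensor_relations_def by blast
  from tensor_relation[OF this] show ?thesis
    by (simp add: ext.tensor_eval_diff ext.tensor_eval_frag_of)
qed

lemma tensor_0_left: "\<tau> 0 a = 0"
  using tensor_add_left[of 0 0 a] by simp

lemma tensor_sum_left: "\<tau> (sum f I) a = (\<Sum>i\<in>I. \<tau> (f i) a)"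
  by (induction I rule: infinite_finite_induct) (auto simp: tensor_0_left tensor_add_left)

text \<open>Transports induction on the free abelian group along the surjection
  \<open>tensor_eval\<close>. Scalars are absorbed into the second factor, so closure under
  differences suffices.\<close>

lemma tensor_induct [case_names tensor diff]:
  assumes "\<And>x a. P (\<tau> x a)" and diff: "\<And>u v. P u \<Longrightarrow> P v \<Longrightarrow> P (u - v)"
  shows "P u"
proof -
  obtain f where "u = tensor_eval t \<tau> f"
    using surj_tensor_eval by blast
  moreover have "P 0" using diff[OF assms(1) assms(1)] by (metis diff_self)
  then have "P (tensor_eval t \<tau> f)"
  proof (induction f rule: frag_induction[OF subset_UNIV])
    case (2 x)
    then show ?case by (cases x) (simp add: ext.tensor_eval_frag_of assms(1))
  qed (auto simp: ext.tensor_eval_0 ext.tensor_eval_diff intro: assms(2))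
  ultimately show ?thesis by simp
qed

text \<open>The homomorphism of the free abelian group given by \<open>\<tau>'\<close> kills the
  relations, which are the kernel of the surjection onto \<open>U\<close>, and hence factors through
  \<open>U\<close>.\<close>

lemma tensor_universal:
  fixes t' :: "'K \<Rightarrow> 'e::ab_group_add \<Rightarrow> 'e"
  assumes "vector_space t'"
    and scale: "\<And>b x a. t' b (\<tau>' x a) = \<tau>' x (b * a)"
    and add_left: "\<And>x y a. \<tau>' (x + y) a = \<tau>' x a + \<tau>' y a"
    and add_right: "\<And>x a b. \<tau>' x (a + b) = \<tau>' x a + \<tau>' x b"
    and scale_left: "\<And>c x a. \<tau>' (s c x) a = \<tau>' x (emb c * a)"
  shows "\<exists>\<phi>. Vector_Spaces.linear t t' \<phi> \<and> (\<forall>x a. \<phi> (\<tau> x a) = \<tau>' x a)"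
proof -
  interpret t': vector_space t' by fact
  let ?E = "tensor_eval t \<tau>" and ?E' = "tensor_eval t' \<tau>'"
  have ker: "?E' f = 0" if "f \<in> group_closure (tensor_relations emb s)" for f
    using that
  proof induction
    case (base f)
    then show ?case
      by (auto simp: tensor_relations_def t'.tensor_eval_0 t'.tensor_eval_diff
          t'.tensor_eval_frag_of add_left add_right scale_left)
  qed (simp add: t'.tensor_eval_diff)
  have wd: "?E' f = ?E' g" if "?E f = ?E g" for f g
  proof -
    have "?E (f - g) = 0" using that by (simp add: ext.tensor_eval_diff)
    then have "?E' (f - g) = 0" using ker kernel_tensor_eval by blast
    then show ?thesis by (simp add: t'.tensor_eval_diff)
  qed
  \<comment> \<open>The choice of a preimage is immaterial by \<open>wd\<close>.\<close>
  define \<phi> where "\<phi> u = ?E' (inv_into UNIV ?E u)" for u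
  have \<phi>: "\<phi> (?E f) = ?E' f" for f
    unfolding \<phi>_def by (rule wd) (simp add: surj_f_inv_f[OF surj_tensor_eval])
  have \<phi>_tensor: "\<phi> (\<tau> x a) = \<tau>' x a" for x a
    using \<phi>[of "frag_of (x, a)"] by (simp add: ext.tensor_eval_frag_of t'.tensor_eval_frag_of)
  have \<phi>_diff: "\<phi> (u - v) = \<phi> u - \<phi> v" for u v
  proof -
    obtain f g where "u = ?E f" "v = ?E g" using surj_tensor_eval by (metis surjD)
    then show ?thesis
      using \<phi>[of "f - g"] by (simp add: \<phi> ext.tensor_eval_diff t'.tensor_eval_diff)
  qed
  have add: "\<phi> (u + v) = \<phi> u + \<phi> v" for u v
    using \<phi>_diff[of "u + v" v] by simp
  have "\<phi> (t b u) = t' b (\<phi> u)" for b u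
  proof (induction u rule: tensor_induct)
    case (tensor x a)
    then show ?case by (simp add: scale_tensor \<phi>_tensor scale)
  next
    case (diff u v)
    then show ?case
      by (simp add: \<phi>_diff ext.scale_right_diff_distrib t'.scale_right_diff_distrib)
  qed
  then have "Vector_Spaces.linear t t' \<phi>"
    using add by unfold_locales auto
  then show ?thesis using \<phi>_tensor by blast
qed

end

section \<open>Coordinates on the extended space\<close>

locale finite_scalar_extension =
  algebraic_extension emb + scalar_extension emb s t \<tau> + base: finite_dimensional_vector_space s B
  for emb :: "'k::field \<Rightarrow> 'K::field"
    and s :: "'k \<Rightarrow> 'v::ab_group_add \<Rightarrow> 'v"
    and t :: "'K \<Rightarrow> 'u::ab_group_add \<Rightarrow> 'u"
    and \<tau> :: "'v \<Rightarrow> 'K \<Rightarrow> 'u"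
    and B
begin

lemma ex_coordinate:
  "\<exists>\<phi>. Vector_Spaces.linear t (*) \<phi> \<and> (\<forall>x a. \<phi> (\<tau> x a) = emb (base.representation B x b) * a)"
proof (rule tensor_universal)
  show "vector_space ((*) :: 'K \<Rightarrow> 'K \<Rightarrow> 'K)" by (rule vector_space_times)
qed (auto simp: algebra_simps base.representation_add base.representation_scale
      base.independent_Basis base.span_Basis emb_add emb_mult)

text \<open>The base change of the \<open>b\<close>-th coordinate functional of \<open>V\<close>. It
  is determined uniquely, as the pure tensors generate \<open>U\<close> additively.\<close>

definition coordinate :: "'v \<Rightarrow> 'u \<Rightarrow> 'K"
  where "coordinate b = (SOME \<phi>. Vector_Spaces.linear t (*) \<phi> \<and>
    (\<forall>x a. \<phi> (\<tau> x a) = emb (base.representation B x b) * a))"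

lemma linear_coordinate: "Vector_Spaces.linear t (*) (coordinate b)"
  and coordinate_tensor: "coordinate b (\<tau> x a) = emb (base.representation B x b) * a"
  using someI_ex[OF ex_coordinate[of b]] unfolding coordinate_def by auto

lemma vector_space_pair_times: "vector_space_pair t ((*) :: 'K \<Rightarrow> 'K \<Rightarrow> 'K)"
  by (intro vector_space_pair.intro ext.vector_space_axioms vector_space_times)

lemmas coordinate_diff = vector_space_pair.linear_diff[OF vector_space_pair_times linear_coordinate]
  and coordinate_add = vector_space_pair.linear_add[OF vector_space_pair_times linear_coordinate]
  and coordinate_scale = vector_space_pair.linear_scale[OF vector_space_pair_times linear_coordinate]
  and coordinate_sum = vector_space_pair.linear_sum[OF vector_space_pair_times linear_coordinate]

lemma sum_coordinates: "(\<Sum>b\<in>B. t (coordinate b u) (\<tau> b 1)) = u"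
proof (induction u rule: tensor_induct)
  case (tensor x a)
  have "(\<Sum>b\<in>B. t (coordinate b (\<tau> x a)) (\<tau> b 1)) =
      \<tau> (\<Sum>b\<in>B. s (base.representation B x b) b) a"
    by (simp add: tensor_sum_left tensor_scale_left coordinate_tensor scale_tensor)
  also have "\<dots> = \<tau> x a"
    using base.sum_representation_eq[OF base.independent_Basis _ base.finite_Basis, of x]
    by (simp add: base.span_Basis)
  finally show ?case .
next
  case (diff u v)
  then show ?case
    by (simp add: coordinate_diff ext.scale_left_diff_distrib sum_subtractf)
qed

lemma coordinate_basis:
  assumes "b' \<in> B"
  shows "coordinate b (\<tau> b' 1) = (if b = b' then 1 else 0)"
  using assms by (simp add: coordinate_tensor base.representation_basis[OF base.independent_Basis]
      emb_0 emb_1)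

lemma inj_on_tensor_basis: "inj_on (\<lambda>b. \<tau> b 1) B"
  by (rule inj_onI) (metis coordinate_basis zero_neq_one)

text \<open>The vectors \<open>b \<otimes> 1\<close> are independent since the coordinate
  functionals separate them, and they span by \<open>sum_coordinates\<close>. So \<open>V\<close>
  and its extension have equal dimension.\<close>

sublocale finite_dimensional_vector_space t "(\<lambda>b. \<tau> b 1) ` B"
proof
  show "finite ((\<lambda>b. \<tau> b 1) ` B)" using base.finite_Basis by simp
  show "ext.independent ((\<lambda>b. \<tau> b 1) ` B)"
  proof (rule ext.independent_if_scalars_zero)
    fix f x assume 0: "(\<Sum>x\<in>(\<lambda>b. \<tau> b 1) ` B. t (f x) x) = 0" and "x \<in> (\<lambda>b. \<tau> b 1) ` B"
    then obtain b where b: "b \<in> B" "x = \<tau> b 1" by blast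
    have "(\<Sum>b\<in>B. t (f (\<tau> b 1)) (\<tau> b 1)) = 0"
      using 0 by (simp add: sum.reindex[OF inj_on_tensor_basis])
    then have "coordinate b (\<Sum>b\<in>B. t (f (\<tau> b 1)) (\<tau> b 1)) = 0"
      using coordinate_scale[of b 0 0] by simp
    then show "f x = 0"
      using b base.finite_Basis
      by (simp add: coordinate_sum coordinate_scale coordinate_basis if_distrib cong: if_cong)
  qed (use base.finite_Basis in simp)
  have "u \<in> ext.span ((\<lambda>b. \<tau> b 1) ` B)" for u
    by (subst sum_coordinates[symmetric]) (intro ext.span_sum ext.span_scale ext.span_base imageI)
  then show "ext.span ((\<lambda>b. \<tau> b 1) ` B) = UNIV" by blast
qed

end

subsection \<open>Comparison of the ranks\<close>

lemma bilinear_formD: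
  assumes "bilinear_form s1 s2 l"
  shows "Vector_Spaces.linear s1 (*) (\<lambda>x. l x y)" "Vector_Spaces.linear s2 (*) (l x)"
  using assms by (auto simp: bilinear_form_def)

lemma bilinear_form_sum_left:
  assumes "bilinear_form s1 s2 l"
  shows "l (\<Sum>i\<in>I. s1 (c i) (v i)) y = (\<Sum>i\<in>I. c i * l (v i) y)"
proof -
  interpret module_hom s1 "(*)" "\<lambda>x. l x y"
    using bilinear_formD(1)[OF assms] by (rule Vector_Spaces.linear.axioms(3))
  show ?thesis by (simp add: sum scale)
qed

lemma bilinear_form_sum_right:
  assumes "bilinear_form s1 s2 l"
  shows "l x (\<Sum>i\<in>I. s2 (c i) (v i)) = (\<Sum>i\<in>I. c i * l x (v i))"
proof -
  interpret module_hom s2 "(*)" "l x"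
    using bilinear_formD(2)[OF assms] by (rule Vector_Spaces.linear.axioms(3))
  show ?thesis by (simp add: sum scale)
qed

lemma bilinear_form_zero_left:
  assumes "bilinear_form s1 s2 l"
  shows "l 0 y = 0"
  using bilinear_form_sum_left[OF assms, of _ _ "{}"] by simp

lemma form_rank_le:
  assumes "module.subspace s1 W1" "module.subspace s2 W2" "\<forall>l\<in>L. \<forall>x\<in>W1. \<forall>y\<in>W2. l x y = 0"
  shows "form_rank s1 s2 L \<le> codim s1 W1 + codim s2 W2"
  unfolding form_rank_def using assms by (intro Least_le) blast

text \<open>The zero subspaces are admissible, so the \<open>LEAST\<close> is a minimum. Asking only
  for \<open>l 0 0 = 0\<close> makes the condition easy to verify on a span.\<close>

lemma form_rank_attained:
  assumes "vector_space s1" "vector_space s2" "\<forall>l\<in>L. l 0 0 = 0"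
  obtains W1 W2 where "module.subspace s1 W1" "module.subspace s2 W2"
    "\<forall>l\<in>L. \<forall>x\<in>W1. \<forall>y\<in>W2. l x y = 0" "form_rank s1 s2 L = codim s1 W1 + codim s2 W2"
proof -
  interpret V1: vector_space s1 by fact
  interpret V2: vector_space s2 by fact
  let ?P = "\<lambda>n. \<exists>W1 W2. V1.subspace W1 \<and> V2.subspace W2 \<and>
    (\<forall>l\<in>L. \<forall>x\<in>W1. \<forall>y\<in>W2. l x y = 0) \<and> n = codim s1 W1 + codim s2 W2"
  have "?P (codim s1 {0} + codim s2 {0})"
    using assms(3) by (intro exI[of _ "{0}"]) auto
  then have "?P (form_rank s1 s2 L)"
    unfolding form_rank_def by (rule LeastI)
  then show thesis using that by blast
qed

section \<open>Descent of isotropic pairs to the base field\<close>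

locale finite_scalar_extension_pair =
  E1: finite_scalar_extension emb s1 t1 \<tau>1 B1 + E2: finite_scalar_extension emb s2 t2 \<tau>2 B2
  for emb :: "'k::field \<Rightarrow> 'K::field"
    and s1 :: "'k \<Rightarrow> 'v1::ab_group_add \<Rightarrow> 'v1" and t1 :: "'K \<Rightarrow> 'u1::ab_group_add \<Rightarrow> 'u1"
    and \<tau>1 :: "'v1 \<Rightarrow> 'K \<Rightarrow> 'u1" and B1
    and s2 :: "'k \<Rightarrow> 'v2::ab_group_add \<Rightarrow> 'v2" and t2 :: "'K \<Rightarrow> 'u2::ab_group_add \<Rightarrow> 'u2"
    and \<tau>2 :: "'v2 \<Rightarrow> 'K \<Rightarrow> 'u2" and B2
begin

text \<open>\<open>extend_forms\<close> collects whatever extensions exist; this shows that every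
  \<open>l\<close> contributes one, built from its matrix in the bases \<open>B1\<close> and
  \<open>B2\<close>.\<close>

lemma extend_form:
  assumes l: "bilinear_form s1 s2 l"
  shows "\<exists>l'. bilinear_form t1 t2 l' \<and> (\<forall>x a y b. l' (\<tau>1 x a) (\<tau>2 y b) = emb (l x y) * a * b)"
proof -
  define l' where "l' u v = (\<Sum>i\<in>B1. \<Sum>j\<in>B2. emb (l i j) * (E1.coordinate i u * E2.coordinate j v))" for u v
  have "bilinear_form t1 t2 l'"
    unfolding bilinear_form_def
  proof (intro allI conjI)
    show "Vector_Spaces.linear t1 (*) (\<lambda>u. l' u v)" for v
      by unfold_locales
        (auto simp: l'_def E1.coordinate_add E1.coordinate_scale algebra_simps sum.distrib sum_distrib_left)
    show "Vector_Spaces.linear t2 (*) (\<lambda>v. l' u v)" for u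
      by unfold_locales
        (auto simp: l'_def E2.coordinate_add E2.coordinate_scale algebra_simps sum.distrib sum_distrib_left)
  qed
  moreover have "l' (\<tau>1 x a) (\<tau>2 y b) = emb (l x y) * a * b" for x a y b
  proof -
    let ?r1 = "E1.base.representation B1 x" and ?r2 = "E2.base.representation B2 y"
    have x: "(\<Sum>i\<in>B1. s1 (?r1 i) i) = x"
      using E1.base.sum_representation_eq[OF E1.base.independent_Basis _ E1.base.finite_Basis, of x]
      by (simp add: E1.base.span_Basis)
    have y: "(\<Sum>i\<in>B2. s2 (?r2 i) i) = y"
      using E2.base.sum_representation_eq[OF E2.base.independent_Basis _ E2.base.finite_Basis, of y]
      by (simp add: E2.base.span_Basis)
    have "l x y = (\<Sum>i\<in>B1. \<Sum>j\<in>B2. ?r1 i * (?r2 j * l i j))"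
      using bilinear_form_sum_left[OF l, of ?r1 "\<lambda>i. i" B1 y]
        bilinear_form_sum_right[OF l, of _ ?r2 "\<lambda>j. j" B2]
      unfolding x y by (simp only: sum_distrib_left)
    then have "emb (l x y) * a * b = (\<Sum>i\<in>B1. \<Sum>j\<in>B2. emb (?r1 i * (?r2 j * l i j)) * (a * b))"
      by (simp only: E1.emb_sum sum_distrib_right mult.assoc)
    also have "\<dots> = l' (\<tau>1 x a) (\<tau>2 y b)"
      unfolding l'_def E1.coordinate_tensor E2.coordinate_tensor E1.emb_mult
      by (intro sum.cong refl) (simp only: mult_ac)
    finally show ?thesis by (rule sym)
  qed
  ultimately show ?thesis by blast
qed

text \<open>The space \<open>U\<close> of the idea above is modelled by \<open>?G1\<close>,
  coefficient families on the basis \<open>C1\<close> of \<open>W1\<close> with values in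
  \<open>?A\<close>, and \<open>Z\<close> by \<open>?G2\<close>, families on \<open>N\<close>. The
  flag is indexed by a basis \<open>D\<close> of \<open>?A\<close>.\<close>

lemma rank_le_codim_of_isotropic_pair:
  assumes L: "\<forall>l\<in>L. bilinear_form s1 s2 l"
    and W1: "E1.ext.subspace W1" and W2: "E2.ext.subspace W2"
    and van: "\<forall>l'\<in>extend_forms emb t1 \<tau>1 t2 \<tau>2 L. \<forall>x\<in>W1. \<forall>y\<in>W2. l' x y = 0"
  shows "form_rank s1 s2 L \<le> codim t1 W1 + codim t2 W2"
proof -
  obtain C1 where C1: "finite C1" "C1 \<subseteq> W1" "E1.ext.independent C1" "E1.ext.span C1 = W1" "card C1 = E1.ext.dim W1"
    using E1.basis_subspace_exists[OF W1] by blast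
  obtain C2 where C2: "finite C2" "C2 \<subseteq> W2" "E2.ext.independent C2" "E2.ext.span C2 = W2" "card C2 = E2.ext.dim W2"
    using E2.basis_subspace_exists[OF W2] by blast
  \<comment> \<open>The complement \<open>N\<close> of \<open>W\<^sub>2\<close> is spanned by vectors \<open>y \<otimes> 1\<close>, so that the values on it of the
    extended forms at combinations from \<open>U\<close> stay in \<open>A\<close> for all of \<open>L\<close> at once.\<close>
  let ?T2 = "(\<lambda>b. \<tau>2 b 1) ` B2"
  obtain C where C: "C2 \<subseteq> C" "C \<subseteq> C2 \<union> ?T2" "E2.ext.independent C" "C2 \<union> ?T2 \<subseteq> E2.ext.span C"
    using E2.ext.maximal_independent_subset_extend[OF _ C2(3), of "C2 \<union> ?T2"] by blast
  have finC: "finite C" using E2.finiteI_independent[OF C(3)] .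
  have "E2.ext.span ?T2 \<subseteq> E2.ext.span C"
    using C(4) by (intro E2.ext.span_minimal) auto
  then have spanC: "E2.ext.span C = UNIV" using E2.span_Basis by auto
  define N where "N = C - C2"
  have finN: "finite N" and N: "N \<subseteq> ?T2" using finC C(2) by (auto simp: N_def)
  define R where "R = E2.ext.representation C"
  have R: "Vector_Spaces.linear t2 (*) (\<lambda>v. R v j)" for j
    unfolding R_def by (rule E2.ext.linear_representation[OF C(3) spanC])
  have R_sum: "v = (\<Sum>j\<in>C. t2 (R v j) j)" for v
    unfolding R_def using E2.ext.sum_representation_eq[OF C(3) _ finC, of v] spanC by simp

  \<comment> \<open>\<open>?A\<close> has to absorb these elements, so that combinations of
    \<open>C1\<close> with coefficients in \<open>?A\<close> have coordinates in
    \<open>?A\<close>.\<close>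
  have "finite ((\<lambda>(b, w). E1.coordinate b w) ` (B1 \<times> C1))"
    using C1(1) E1.base.finite_Basis by simp
  from E1.finite_stable_subspace[OF this] obtain F where F: "finite F" "1 \<in> F"
    and stable: "\<And>b w a. b \<in> B1 \<Longrightarrow> w \<in> C1 \<Longrightarrow> a \<in> E1.K.span F \<Longrightarrow> E1.coordinate b w * a \<in> E1.K.span F"
    by auto
  let ?A = "E1.K.span F"
  obtain D where D: "D \<subseteq> F" "E1.K.independent D" "F \<subseteq> E1.K.span D"
    using E1.K.maximal_independent_subset by blast
  have finD: "finite D" using D(1) F(1) finite_subset by blast
  have A: "?A = E1.K.span D"
    using D by (metis E1.K.span_eq E1.K.span_mono E1.K.span_span subset_antisym)
  have dimA: "E1.K.dim ?A = card D"
    unfolding A by (rule E1.K.dim_span_eq_card_independent[OF D(2)])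
  have "D \<noteq> {}" using A E1.K.span_base[OF F(2)] by auto
  then have "card D > 0" using finD by (simp add: card_gt_0_iff)
  \<comment> \<open>The coordinates of \<open>?A\<close> in the basis \<open>D\<close>, extended
    linearly to all of \<open>K\<close> by completing \<open>D\<close> to a basis.\<close>
  define f where "f i x = E1.K.representation (E1.K.extend_basis D) x i" for i x
  have f: "Vector_Spaces.linear (\<lambda>c. (*) (emb c)) (*) (f i)" for i
    unfolding f_def
    by (rule E1.K.linear_representation)
      (simp_all add: E1.K.independent_extend_basis[OF D(2)] E1.K.span_extend_basis[OF D(2)])
  have f_zero: "a = 0" if "a \<in> ?A" "\<forall>i\<in>D. f i a = 0" for a
  proof -
    have a: "a \<in> E1.K.span D" using that A by simp
    have "f i a = E1.K.representation D a i" for i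
      unfolding f_def
      using E1.K.representation_extend[OF E1.K.independent_extend_basis[OF D(2)] a
          E1.K.extend_basis_superset[OF D(2)]] by simp
    then show ?thesis
      using that(2) E1.K.sum_representation_eq[OF D(2) a finD order_refl] by simp
  qed
  interpret f: module_hom "\<lambda>c. (*) (emb c)" "(*)" "f i" for i
    using f by (rule Vector_Spaces.linear.axioms(3))

  define comb where "comb g = (\<Sum>w\<in>C1. t1 (g w) w)" for g
  have comb_W1: "comb g \<in> W1" for g
    unfolding comb_def C1(4)[symmetric]
    by (intro E1.ext.span_sum E1.ext.span_scale E1.ext.span_base)
  have comb_add: "comb (g + h) = comb g + comb h" for g h
    by (simp add: comb_def E1.ext.scale_left_distrib sum.distrib)
  have comb_scale: "comb (\<lambda>w. a * g w) = t1 a (comb g)" for a g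
    by (simp add: comb_def E1.ext.scale_sum_right)
  \<comment> \<open>The \<open>i\<close>-th component of \<open>comb g\<close> when
    \<open>V\<^sub>1 \<otimes> A\<close> is identified with a power of
    \<open>V\<^sub>1\<close>.\<close>
  define p where "p i g = (\<Sum>b\<in>B1. s1 (f i (E1.coordinate b (comb g))) b)" for i g
  \<comment> \<open>The sum is the value at \<open>y \<otimes> 1\<close> of the functional that is
    \<open>z\<close> on \<open>N\<close> and zero on \<open>W2\<close>. It may lie outside
    \<open>?A\<close> for a general \<open>z\<close>, hence the extension of \<open>f i\<close> to
    \<open>K\<close>.\<close>
  define q where "q i z y = f i (\<Sum>j\<in>N. z j * R (\<tau>2 y 1) j)" for i and z :: "'u2 \<Rightarrow> 'K" and y
  let ?G1 = "{g::'u1 \<Rightarrow> 'K. (\<forall>x. x \<notin> C1 \<longrightarrow> g x = 0) \<and> (\<forall>x. g x \<in> ?A)}"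
  let ?G2 = "{g::'u2 \<Rightarrow> 'K. (\<forall>x. x \<notin> N \<longrightarrow> g x = 0) \<and> (\<forall>x. g x \<in> ?A)}"
  let ?s = "\<lambda>c. (*) (emb c)"
  interpret X: vector_space "fun_scale ?s :: 'k \<Rightarrow> ('u1 \<Rightarrow> 'K) \<Rightarrow> ('u1 \<Rightarrow> 'K)"
    by (rule E1.K.vector_space_fun_scale)
  interpret Y: vector_space "fun_scale ?s :: 'k \<Rightarrow> ('u2 \<Rightarrow> 'K) \<Rightarrow> ('u2 \<Rightarrow> 'K)"
    by (rule E1.K.vector_space_fun_scale)
  note finsupp = E1.K.finitely_supported_functions[OF E1.K.subspace_span F(1) order_refl]
  obtain F1 where F1: "finite F1" "?G1 \<subseteq> X.span F1"
    using finsupp[OF C1(1)] by blast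
  obtain F2 where F2: "finite F2" "?G2 \<subseteq> Y.span F2"
    using finsupp[OF finN] by blast
  have coord_A: "E1.coordinate b (comb g) \<in> ?A" if "g \<in> ?G1" "b \<in> B1" for g b
  proof -
    have "E1.coordinate b (comb g) = (\<Sum>w\<in>C1. E1.coordinate b w * g w)"
      by (simp add: comb_def E1.coordinate_sum E1.coordinate_scale mult.commute)
    then show ?thesis using that stable by (auto intro!: E1.K.span_sum)
  qed

  have p_add: "p i (g + h) = p i g + p i h" for i g h
    by (simp add: p_def comb_add E1.coordinate_add f.add E1.base.scale_left_distrib sum.distrib)
  have p_scale: "p i (fun_scale ?s c g) = s1 c (p i g)" for i c g
    by (simp add: p_def fun_scale_def comb_scale E1.coordinate_scale f.scale E1.base.scale_sum_right)
  have p_linear: "Vector_Spaces.linear (fun_scale ?s) s1 (p i)" for i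
    unfolding Vector_Spaces.linear_iff
    by (intro conjI allI X.vector_space_axioms E1.base.vector_space_axioms p_add p_scale)
  have q_add: "q i (g + h) = q i g + q i h" for i g h
    by (simp add: q_def fun_eq_iff distrib_right sum.distrib f.add)
  have q_scale: "q i (fun_scale ?s c g) = fun_scale (*) c (q i g)" for i c g
    by (simp add: q_def fun_eq_iff fun_scale_def mult.assoc f.scale flip: sum_distrib_left)
  have q_linear: "Vector_Spaces.linear (fun_scale ?s) (fun_scale (*)) (q i)" for i
    unfolding Vector_Spaces.linear_iff
    by (intro conjI allI Y.vector_space_axioms q_add q_scale
        vector_space.vector_space_fun_scale[OF vector_space_times])
  note R_add = module_hom.add[OF Vector_Spaces.linear.axioms(3)[OF R]]
    and R_scale = module_hom.scale[OF Vector_Spaces.linear.axioms(3)[OF R]]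
  have qz_add: "q i z (x + y) = q i z x + q i z y" for i z x y
    by (simp add: q_def E2.tensor_add_left R_add distrib_left sum.distrib f.add)
  have "\<tau>2 (s2 c y) 1 = t2 (emb c) (\<tau>2 y 1)" for c y
    by (simp add: E2.tensor_scale_left E2.scale_tensor)
  then have qz_scale: "q i z (s2 c y) = c * q i z y" for i z c y
    by (simp add: q_def R_scale mult.left_commute f.scale flip: sum_distrib_left)
  have qz_linear: "Vector_Spaces.linear s2 (*) (q i z)" for i z
    unfolding Vector_Spaces.linear_iff
    by (intro conjI allI E2.base.vector_space_axioms vector_space_times qz_add qz_scale)

  have "X.dim ?G1 + card D * form_rank s1 s2 L \<le> card D * E1.base.dim UNIV + Y.dim ?G2"
  proof (rule flag_dimension_inequality[where p = p and q = q and L = L])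
    show "finite_dimensional_vector_space s1 B1" "finite_dimensional_vector_space s2 B2"
      by unfold_locales
    show "form_rank s1 s2 L \<le> codim s1 V1 + codim s2 V2"
      if "E1.base.subspace V1" "E2.base.subspace V2" "\<forall>l\<in>L. \<forall>x\<in>V1. \<forall>y\<in>V2. l x y = 0" for V1 V2
      using that by (rule form_rank_le)
    show "l 0 = 0" if "l \<in> L" for l
      using bilinear_form_zero_left[of s1 s2 l] L that by (simp add: fun_eq_iff)
    show "X.subspace ?G1" using finsupp[OF C1(1)] by blast
    show "Y.subspace ?G2" using finsupp[OF finN] by blast
    show "u = 0" if u: "u \<in> ?G1" and 0: "\<forall>i\<in>D. p i u = 0" for u
    proof -
      \<comment> \<open>Independence is used in three layers: of \<open>B1\<close> here, of
        \<open>D\<close> through \<open>f_zero\<close>, and finally of \<open>C1\<close>.\<close>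
      have "f i (E1.coordinate b (comb u)) = 0" if "i \<in> D" "b \<in> B1" for i b
      proof -
        have "(\<Sum>b\<in>B1. s1 (f i (E1.coordinate b (comb u))) b) = 0"
          using 0 that(1) by (simp add: p_def)
        then show ?thesis
          using E1.base.independent_Basis that(2) unfolding E1.base.independent_explicit by auto
      qed
      then have "E1.coordinate b (comb u) = 0" if "b \<in> B1" for b
        using that f_zero[OF coord_A[OF u that]] by blast
      then have "comb u = 0"
        using E1.sum_coordinates[of "comb u"] by simp
      then have "u w = 0" if "w \<in> C1" for w
        using C1(3) that unfolding comb_def E1.independent_explicit by auto
      then show "u = 0" using u by (auto simp: fun_eq_iff)
    qed
    show "\<exists>z\<in>?G2. \<forall>i\<in>D. q i z = l (p i u)" if l: "l \<in> L" and u: "u \<in> ?G1" for l u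
    proof -
      have bl: "bilinear_form s1 s2 l" using L l by blast
      obtain l' where l': "bilinear_form t1 t2 l'"
        and l'_tensor: "\<And>x a y b. l' (\<tau>1 x a) (\<tau>2 y b) = emb (l x y) * a * b"
        using extend_form[OF bl] by blast
      interpret M: vector_space "form_scale :: 'K \<Rightarrow> ('u1 \<Rightarrow> 'u2 \<Rightarrow> 'K) \<Rightarrow> _"
        by (rule vector_space_form_scale)
      have "l' \<in> extend_forms emb t1 \<tau>1 t2 \<tau>2 L"
        unfolding extend_forms_def using l' l'_tensor l by (intro M.span_base) blast
      then have zero: "l' x y = 0" if "x \<in> W1" "y \<in> W2" for x y using van that by blast
      have l'_comb: "l' (comb u) (\<tau>2 y 1) = (\<Sum>b\<in>B1. emb (l b y) * E1.coordinate b (comb u))" for y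
      proof -
        have "l' (comb u) (\<tau>2 y 1) = l' (\<Sum>b\<in>B1. t1 (E1.coordinate b (comb u)) (\<tau>1 b 1)) (\<tau>2 y 1)"
          by (simp add: E1.sum_coordinates)
        then show ?thesis
          by (simp add: bilinear_form_sum_left[OF l'] l'_tensor mult.commute)
      qed
      \<comment> \<open>The partner of \<open>u\<close> records the extended form on
        \<open>N\<close>; the default 0 is the support condition of \<open>?G2\<close>.\<close>
      define z where "z j = (if j \<in> N then l' (comb u) j else 0)" for j
      have "z j \<in> ?A" for j
      proof (cases "j \<in> N")
        case True
        then obtain y where "j = \<tau>2 y 1" using N by blast
        then show ?thesis
          using True coord_A[OF u] by (auto simp: z_def l'_comb intro!: E1.K.span_sum E1.K.span_scale)
      qed (simp add: z_def E1.K.span_zero)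
      then have "z \<in> ?G2" by (simp add: z_def)
      moreover have "q i z y = l (p i u) y" for i y
      proof -
        let ?v = "\<tau>2 y 1"
        have "l' (comb u) ?v = (\<Sum>j\<in>C. R ?v j * l' (comb u) j)"
          by (subst R_sum[of ?v]) (rule bilinear_form_sum_right[OF l'])
        \<comment> \<open>The terms from \<open>C2\<close> vanish, as \<open>comb u\<close> lies in
          \<open>W1\<close> and \<open>C2\<close> in \<open>W2\<close>.\<close>
        also have "\<dots> = (\<Sum>j\<in>N. R ?v j * l' (comb u) j)"
          using finC C2(2) zero[OF comb_W1]
          by (intro sum.mono_neutral_right) (auto simp: N_def)
        also have "\<dots> = (\<Sum>j\<in>N. z j * R ?v j)"
          by (simp add: z_def mult.commute)
        finally have "q i z y = f i (\<Sum>b\<in>B1. emb (l b y) * E1.coordinate b (comb u))"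
          by (simp add: q_def l'_comb)
        \<comment> \<open>The values \<open>l b y\<close> are scalars of the base field, over which
          \<open>f i\<close> is linear.\<close>
        also have "\<dots> = (\<Sum>b\<in>B1. f i (E1.coordinate b (comb u)) * l b y)"
          by (simp add: f.sum f.scale mult.commute)
        also have "\<dots> = l (p i u) y"
          by (simp add: p_def bilinear_form_sum_left[OF bl])
        finally show ?thesis .
      qed
      ultimately show ?thesis by (auto simp: fun_eq_iff)
    qed
    show "vector_space (fun_scale ?s :: 'k \<Rightarrow> ('u1 \<Rightarrow> 'K) \<Rightarrow> _)" by (rule X.vector_space_axioms)
    show "vector_space (fun_scale ?s :: 'k \<Rightarrow> ('u2 \<Rightarrow> 'K) \<Rightarrow> _)" by (rule Y.vector_space_axioms)
  qed (rule p_linear q_linear qz_linear finD F1 F2)+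
  moreover have "X.dim ?G1 = card C1 * card D"
    using finsupp[OF C1(1)] dimA by simp
  moreover have "Y.dim ?G2 = card N * card D"
    using finsupp[OF finN] dimA by simp
  ultimately have "card D * (card C1 + form_rank s1 s2 L) \<le> card D * (E1.base.dim UNIV + card N)"
    by (simp add: algebra_simps)
  then have "card C1 + form_rank s1 s2 L \<le> E1.base.dim UNIV + card N"
    using \<open>card D > 0\<close> by simp
  \<comment> \<open>The vectors \<open>b \<otimes> 1\<close> form a basis over \<open>K\<close> with
    as many elements as \<open>B1\<close>.\<close>
  moreover have "codim t1 W1 = E1.base.dim UNIV - card C1"
    using card_image[OF E1.inj_on_tensor_basis] C1(5) by (simp add: codim_def)
  moreover have "codim t2 W2 = card N"
  proof -
    have "E2.ext.dim UNIV = card C"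
      using E2.ext.dim_span_eq_card_independent[OF C(3)] spanC by simp
    then show ?thesis
      using C2(1,5) C(1) by (simp add: codim_def N_def card_Diff_subset)
  qed
  ultimately show ?thesis by linarith
qed

lemma form_rank_le_extension:
  assumes "\<forall>l\<in>L. bilinear_form s1 s2 l"
  shows "form_rank s1 s2 L \<le> form_rank t1 t2 (extend_forms emb t1 \<tau>1 t2 \<tau>2 L)"
proof -
  interpret M: vector_space "form_scale :: 'K \<Rightarrow> ('u1 \<Rightarrow> 'u2 \<Rightarrow> 'K) \<Rightarrow> _"
    by (rule vector_space_form_scale)
  \<comment> \<open>Needed for the minimum over the extension to be attained by some pair.\<close>
  have "l' 0 0 = 0" if "l' \<in> extend_forms emb t1 \<tau>1 t2 \<tau>2 L" for l'
    using that unfolding extend_forms_def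
  proof (induction rule: M.span_induct_alt)
    case base
    then show ?case by simp
  next
    case (step c l' l'')
    then have "bilinear_form t1 t2 l'" by blast
    then show ?case using step.IH by (simp add: form_scale_def bilinear_form_zero_left)
  qed
  then have "\<forall>l'\<in>extend_forms emb t1 \<tau>1 t2 \<tau>2 L. l' 0 0 = 0" by blast
  from form_rank_attained[OF E1.ext.vector_space_axioms E2.ext.vector_space_axioms this]
  obtain W1 W2 where W: "E1.ext.subspace W1" "E2.ext.subspace W2"
    "\<forall>l'\<in>extend_forms emb t1 \<tau>1 t2 \<tau>2 L. \<forall>x\<in>W1. \<forall>y\<in>W2. l' x y = 0"
    "form_rank t1 t2 (extend_forms emb t1 \<tau>1 t2 \<tau>2 L) = codim t1 W1 + codim t2 W2" .
  show ?thesis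
    unfolding W(4) by (rule rank_le_codim_of_isotropic_pair[OF assms W(1-3)])
qed

end

theorem theorem1p17:
  fixes s1 :: "'k::field \<Rightarrow> 'v1::ab_group_add \<Rightarrow> 'v1"
    and s2 :: "'k \<Rightarrow> 'v2::ab_group_add \<Rightarrow> 'v2"
    and t1 :: "'k alg_closure \<Rightarrow> 'u1::ab_group_add \<Rightarrow> 'u1"
    and t2 :: "'k alg_closure \<Rightarrow> 'u2::ab_group_add \<Rightarrow> 'u2"
    and \<tau>1 :: "'v1 \<Rightarrow> 'k alg_closure \<Rightarrow> 'u1"
    and \<tau>2 :: "'v2 \<Rightarrow> 'k alg_closure \<Rightarrow> 'u2"
    and L :: "('v1 \<Rightarrow> 'v2 \<Rightarrow> 'k) set"
  assumes "finite_dimensional_vector_space s1 B1"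
    and "finite_dimensional_vector_space s2 B2"
    and "scalar_extension to_ac s1 t1 \<tau>1"
    and "scalar_extension to_ac s2 t2 \<tau>2"
    and "L \<subseteq> {l. bilinear_form s1 s2 l}"
    and "module.subspace form_scale L"
  shows "form_rank s1 s2 L \<le> 2 * form_rank t1 t2 (extend_forms to_ac t1 \<tau>1 t2 \<tau>2 L)"
proof -
  interpret finite_scalar_extension_pair to_ac s1 t1 \<tau>1 B1 s2 t2 \<tau>2 B2
    using assms(1-4) algebraic_extension_to_ac
    by (intro finite_scalar_extension_pair.intro finite_scalar_extension.intro)
  have "form_rank s1 s2 L \<le> form_rank t1 t2 (extend_forms to_ac t1 \<tau>1 t2 \<tau>2 L)"
    using form_rank_le_extension assms(5) by blast
  then show ?thesis by simp
qed

end
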